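(* Let $X$ be a metrizable space and let $w\in\mathrm{CPM}(X)$. Then the set $\mathrm{I}(w)$ of all $d\in\mathrm{CPM}(X)$ such that the identity map $1_X\colon(X,d)\to(X,w)$ is uniformly continuous is comeager in $(\mathrm{CPM}(X),\mathcal{D}_X)$.
   Context: A pseudometric on a set $X$ is a map $d\colon X\times X\to[0,\infty)$ with $d(x,x)=0$, $d(x,y)=d(y,x)$ and $d(x,y)\le d(x,z)+d(z,y)$ for all $x,y,z\in X$. For a topological space $X$, $\mathrm{CPM}(X)$ denotes the set of all pseudometrics $d$ on $X$ that are continuous as maps $X\times X\to[0,\infty)$. Define $\mathcal{D}_X\colon \mathrm{CPM}(X)^2\to[0,\infty]$ by $\mathcal{D}_X(d,e)=\sup_{x,y\in X}|d(x,y)-e(x,y)|$; although it may take the value $\infty$, it induces a topology on $\mathrm{CPM}(X)$ via open balls as for ordinary metrics, and $\mathrm{CPM}(X)$ carries this topology. Uniform continuity of $1_X\colon(X,d)\to(X,w)$ means: for every $\epsilon\in(0,\infty)$ there exists $\delta\in(0,\infty)$ such that for all $x,y\in X$, $d(x,y)<\delta$ implies $w(x,y)<\epsilon$. A subset $S$ of a topological space $M$ is comeager if there is a sequence $\{G_n\}_{n\in\mathbb{Z}_{\ge0}}$ of open dense subsets of $M$ with $\bigcap_{n}G_n\subseteq S$. *)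

theory Defs
  imports "HOL-Analysis.Analysis"
begin

text \<open>A map from S x S to the nonnegative reals is encoded as an extensional function on pairs,
  so that two pseudometrics on S are equal as soon as they agree on S x S.\<close>

definition pseudometric_on :: "'a set \<Rightarrow> ('a \<times> 'a \<Rightarrow> real) \<Rightarrow> bool" where
  "pseudometric_on S d \<longleftrightarrow>
     d \<in> S \<times> S \<rightarrow>\<^sub>E {0..} \<and>
     (\<forall>x\<in>S. d (x, x) = 0) \<and>
     (\<forall>x\<in>S. \<forall>y\<in>S. d (x, y) = d (y, x)) \<and>
     (\<forall>x\<in>S. \<forall>y\<in>S. \<forall>z\<in>S. d (x, y) \<le> d (x, z) + d (z, y))"

definition CPM :: "'a topology \<Rightarrow> ('a \<times> 'a \<Rightarrow> real) set" where
  "CPM X = {d. pseudometric_on (topspace X) d \<and>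
               continuous_map (prod_topology X X) (top_of_set {0..}) d}"

definition CPM_dist ::
  "'a topology \<Rightarrow> ('a \<times> 'a \<Rightarrow> real) \<Rightarrow> ('a \<times> 'a \<Rightarrow> real) \<Rightarrow> ennreal" where
  "CPM_dist X d e = (SUP p \<in> topspace X \<times> topspace X. ennreal \<bar>d p - e p\<bar>)"

definition CPM_ball ::
  "'a topology \<Rightarrow> ('a \<times> 'a \<Rightarrow> real) \<Rightarrow> real \<Rightarrow> ('a \<times> 'a \<Rightarrow> real) set" where
  "CPM_ball X d r = {e \<in> CPM X. CPM_dist X d e < ennreal r}"

definition CPM_topology :: "'a topology \<Rightarrow> ('a \<times> 'a \<Rightarrow> real) topology" where
  "CPM_topology X =
     topology (\<lambda>U. U \<subseteq> CPM X \<and> (\<forall>d\<in>U. \<exists>r>0. CPM_ball X d r \<subseteq> U))"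

lemma CPM_ball_mono: "r \<le> s \<Longrightarrow> CPM_ball X d r \<subseteq> CPM_ball X d s"
  unfolding CPM_ball_def using ennreal_leI order_less_le_trans by blast

lemma istopology_CPM:
  "istopology (\<lambda>U. U \<subseteq> CPM X \<and> (\<forall>d\<in>U. \<exists>r>0. CPM_ball X d r \<subseteq> U))"
proof -
  have "\<exists>r>0. CPM_ball X d r \<subseteq> S \<inter> T"
    if "\<exists>r>0. CPM_ball X d r \<subseteq> S" and "\<exists>s>0. CPM_ball X d s \<subseteq> T" for S T d
  proof -
    from that obtain r s where "r > 0" "CPM_ball X d r \<subseteq> S" "s > 0" "CPM_ball X d s \<subseteq> T"
      by auto
    then have "min r s > 0 \<and> CPM_ball X d (min r s) \<subseteq> S \<inter> T"
      using CPM_ball_mono[of "min r s" r X d] CPM_ball_mono[of "min r s" s X d] by auto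
    then show ?thesis ..
  qed
  then show ?thesis
    unfolding istopology_def
    apply (intro conjI allI impI ballI)
       apply blast
      apply simp
     apply blast
    apply (erule UnionE)
    apply (drule bspec, assumption)
    apply (meson Union_upper order_trans)
    done
qed

lemma openin_CPM_topology:
  "openin (CPM_topology X) U \<longleftrightarrow>
     U \<subseteq> CPM X \<and> (\<forall>d\<in>U. \<exists>r>0. CPM_ball X d r \<subseteq> U)"
  unfolding CPM_topology_def by (simp add: topology_inverse'[OF istopology_CPM])

lemma topspace_CPM_topology [simp]: "topspace (CPM_topology X) = CPM X"
proof (rule antisym)
  show "topspace (CPM_topology X) \<subseteq> CPM X"
    using openin_topspace[of "CPM_topology X"] unfolding openin_CPM_topology by blast
  have "openin (CPM_topology X) (CPM X)"
    unfolding openin_CPM_topology CPM_ball_def by (auto intro: exI[of _ 1])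
  then show "CPM X \<subseteq> topspace (CPM_topology X)"
    by (rule openin_subset)
qed

definition uniformly_continuous_id ::
  "'a set \<Rightarrow> ('a \<times> 'a \<Rightarrow> real) \<Rightarrow> ('a \<times> 'a \<Rightarrow> real) \<Rightarrow> bool" where
  "uniformly_continuous_id S d w \<longleftrightarrow>
     (\<forall>\<epsilon>>0. \<exists>\<delta>>0. \<forall>x\<in>S. \<forall>y\<in>S. d (x, y) < \<delta> \<longrightarrow> w (x, y) < \<epsilon>)"

definition unif_id_set ::
  "'a topology \<Rightarrow> ('a \<times> 'a \<Rightarrow> real) \<Rightarrow> ('a \<times> 'a \<Rightarrow> real) set" where
  "unif_id_set X w = {d \<in> CPM X. uniformly_continuous_id (topspace X) d w}"

definition comeager_in :: "'a topology \<Rightarrow> 'a set \<Rightarrow> bool" where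
  "comeager_in M S \<longleftrightarrow>
     S \<subseteq> topspace M \<and>
     (\<exists>G :: nat \<Rightarrow> 'a set.
        (\<forall>n. openin M (G n) \<and> M closure_of (G n) = topspace M) \<and> (\<Inter>n. G n) \<subseteq> S)"

end

theory Submission
  imports Defs
begin

text \<open>
  Uniform continuity of the identity is a countable conjunction: for each \<open>\<epsilon> = 1/(n+1)\<close> there has to
  be a \<open>\<delta>\<close> that serves \<open>\<epsilon>\<close>. A single such condition is open, because a pseudometric that differs
  from \<open>d\<close> by less than \<open>\<delta>/2\<close> still satisfies it with \<open>\<delta>/2\<close> in place of \<open>\<delta>\<close>
  (\<open>openin_modulus_set\<close>).

  It is also dense, since the whole set of good pseudometrics is: adding the truncation
  \<open>min w c\<close> to an arbitrary \<open>d\<close> moves it by at most \<open>c\<close>, yields a continuous pseudometric again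
  (\<open>add_truncation_in_CPM\<close>), and forces \<open>w\<close> to be small wherever the new pseudometric is small
  (\<open>closure_of_unif_id_set\<close>).
\<close>

text \<open>The conditions for a single \<open>\<epsilon>\<close>, whose intersection over \<open>\<epsilon> > 0\<close> is \<^const>\<open>unif_id_set\<close>.\<close>

definition modulus_set ::
  "'a topology \<Rightarrow> ('a \<times> 'a \<Rightarrow> real) \<Rightarrow> real \<Rightarrow> ('a \<times> 'a \<Rightarrow> real) set" where
  "modulus_set X w \<epsilon> =
     {d \<in> CPM X. \<exists>\<delta>>0. \<forall>x\<in>topspace X. \<forall>y\<in>topspace X. d (x, y) < \<delta> \<longrightarrow> w (x, y) < \<epsilon>}"

lemma unif_id_set_subset_modulus_set:
  "\<epsilon> > 0 \<Longrightarrow> unif_id_set X w \<subseteq> modulus_set X w \<epsilon>"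
  by (auto simp: unif_id_set_def uniformly_continuous_id_def modulus_set_def)

lemma Inter_modulus_set_subset_unif_id_set:
  "(\<Inter>n. modulus_set X w (inverse (real (Suc n)))) \<subseteq> unif_id_set X w"
proof
  fix d assume d: "d \<in> (\<Inter>n. modulus_set X w (inverse (real (Suc n))))"
  have "\<exists>\<delta>>0. \<forall>x\<in>topspace X. \<forall>y\<in>topspace X. d (x, y) < \<delta> \<longrightarrow> w (x, y) < \<epsilon>"
    if pos: "\<epsilon> > 0" for \<epsilon> :: real
  proof -
    obtain n where n: "inverse (real (Suc n)) < \<epsilon>"
      using reals_Archimedean[OF pos] by blast
    from d have "d \<in> modulus_set X w (inverse (real (Suc n)))" by blast
    then show ?thesis
      unfolding modulus_set_def using n by (blast intro: less_trans)
  qed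
  moreover have "d \<in> CPM X"
    using d by (auto simp: modulus_set_def)
  ultimately show "d \<in> unif_id_set X w"
    by (simp add: unif_id_set_def uniformly_continuous_id_def)
qed

lemma CPM_ball_imp_abs_diff_less:
  assumes "e \<in> CPM_ball X d r" "x \<in> topspace X" "y \<in> topspace X"
  shows "\<bar>d (x, y) - e (x, y)\<bar> < r"
proof -
  have "ennreal \<bar>d (x, y) - e (x, y)\<bar> \<le> CPM_dist X d e"
    unfolding CPM_dist_def using assms by (intro SUP_upper) auto
  also have "\<dots> < ennreal r"
    using assms(1) by (simp add: CPM_ball_def)
  finally show ?thesis
    by (simp add: ennreal_less_iff)
qed

lemma openin_modulus_set: "openin (CPM_topology X) (modulus_set X w \<epsilon>)"
  unfolding openin_CPM_topology
proof (intro conjI ballI)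
  show "modulus_set X w \<epsilon> \<subseteq> CPM X"
    by (auto simp: modulus_set_def)
next
  fix d assume "d \<in> modulus_set X w \<epsilon>"
  then obtain \<delta> where \<delta>: "\<delta> > 0"
    "\<And>x y. x \<in> topspace X \<Longrightarrow> y \<in> topspace X \<Longrightarrow> d (x, y) < \<delta> \<Longrightarrow> w (x, y) < \<epsilon>"
    by (auto simp: modulus_set_def)
  have "CPM_ball X d (\<delta>/2) \<subseteq> modulus_set X w \<epsilon>"
  proof
    fix e assume e: "e \<in> CPM_ball X d (\<delta>/2)"
    have "w (x, y) < \<epsilon>" if xy: "x \<in> topspace X" "y \<in> topspace X" "e (x, y) < \<delta>/2" for x y
    proof -
      have "d (x, y) < \<delta>"
        using CPM_ball_imp_abs_diff_less[OF e xy(1,2)] xy(3) by linarith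
      then show ?thesis
        using \<delta>(2) xy by blast
    qed
    moreover have "\<delta>/2 > 0" "e \<in> CPM X"
      using \<delta>(1) e by (auto simp: CPM_ball_def)
    ultimately show "e \<in> modulus_set X w \<epsilon>"
      unfolding modulus_set_def by blast
  qed
  then show "\<exists>r>0. CPM_ball X d r \<subseteq> modulus_set X w \<epsilon>"
    using \<delta>(1) by (intro exI[of _ "\<delta>/2"]) auto
qed

definition add_truncation ::
  "'a topology \<Rightarrow> ('a \<times> 'a \<Rightarrow> real) \<Rightarrow> ('a \<times> 'a \<Rightarrow> real) \<Rightarrow> real \<Rightarrow> ('a \<times> 'a \<Rightarrow> real)" where
  "add_truncation X d w c =
     restrict (\<lambda>p. d p + min (w p) c) (topspace X \<times> topspace X)"

text \<open>Truncation keeps the triangle inequality because \<open>t \<mapsto> min t c\<close> is monotone and, on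
  nonnegative arguments, subadditive.\<close>

lemma add_truncation_in_CPM:
  assumes d: "d \<in> CPM X" and w: "w \<in> CPM X" and c: "c \<ge> 0"
  shows "add_truncation X d w c \<in> CPM X"
proof -
  let ?S = "topspace X" and ?e = "add_truncation X d w c"
  have pd: "pseudometric_on ?S d" and pw: "pseudometric_on ?S w"
    and cd: "continuous_map (prod_topology X X) (top_of_set {0..}) d"
    and cw: "continuous_map (prod_topology X X) (top_of_set {0..}) w"
    using d w by (auto simp: CPM_def)
  have nonneg: "d (x, y) \<ge> 0" "w (x, y) \<ge> 0" if "x \<in> ?S" "y \<in> ?S" for x y
    using pd pw that by (auto simp: pseudometric_on_def PiE_iff)
  have e_eq: "?e (x, y) = d (x, y) + min (w (x, y)) c" if "x \<in> ?S" "y \<in> ?S" for x y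
    using that by (simp add: add_truncation_def)
  have e_nonneg: "?e \<in> ?S \<times> ?S \<rightarrow>\<^sub>E {0..}"
    using nonneg c by (auto simp: add_truncation_def)
  have triangle: "?e (x, y) \<le> ?e (x, z) + ?e (z, y)"
    if xyz: "x \<in> ?S" "y \<in> ?S" "z \<in> ?S" for x y z
  proof -
    have "d (x, y) \<le> d (x, z) + d (z, y)" "w (x, y) \<le> w (x, z) + w (z, y)"
      using pd pw xyz by (auto simp: pseudometric_on_def)
    then show ?thesis
      using nonneg[of x z] nonneg[of z y] xyz c by (simp add: e_eq min_def)
  qed
  have "pseudometric_on ?S ?e"
    unfolding pseudometric_on_def
  proof (intro conjI ballI)
    fix x assume "x \<in> ?S"
    then show "?e (x, x) = 0"
      using pd pw c by (simp add: e_eq pseudometric_on_def)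
  next
    fix x y assume "x \<in> ?S" "y \<in> ?S"
    moreover from this have "d (x, y) = d (y, x)" "w (x, y) = w (y, x)"
      using pd pw by (auto simp: pseudometric_on_def)
    ultimately show "?e (x, y) = ?e (y, x)"
      by (simp add: e_eq)
  qed (use e_nonneg triangle in auto)
  moreover have "continuous_map (prod_topology X X) (top_of_set {0..}) ?e"
  proof -
    have "continuous_map (prod_topology X X) euclideanreal (\<lambda>p. d p + min (w p) c)"
      using cd cw
      by (intro continuous_map_add continuous_map_real_min)
        (auto simp: continuous_map_in_subtopology)
    then have "continuous_map (prod_topology X X) euclideanreal ?e"
      by (rule continuous_map_eq) (auto simp: add_truncation_def)
    then show ?thesis
      using e_nonneg by (auto simp: continuous_map_in_subtopology PiE_iff)
  qed
  ultimately show ?thesis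
    by (simp add: CPM_def)
qed

lemma CPM_dist_add_truncation_le:
  assumes "w \<in> CPM X" "c \<ge> 0"
  shows "CPM_dist X d (add_truncation X d w c) \<le> ennreal c"
proof -
  have "w p \<ge> 0" if "p \<in> topspace X \<times> topspace X" for p
    using assms(1) that by (auto simp: CPM_def pseudometric_on_def PiE_iff)
  then show ?thesis
    unfolding CPM_dist_def add_truncation_def using assms(2)
    by (intro SUP_least ennreal_leI) auto
qed

text \<open>If \<open>d + min w c\<close> is below \<open>min \<epsilon> c\<close>, then so is \<open>min w c\<close>; the truncation is then inactive,
  and \<open>w < \<epsilon>\<close>. This uniformity costs only the perturbation \<open>c\<close>, which is arbitrarily small.\<close>

lemma add_truncation_in_unif_id_set:
  assumes d: "d \<in> CPM X" and w: "w \<in> CPM X" and c: "c > 0"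
  shows "add_truncation X d w c \<in> unif_id_set X w"
proof -
  have "w (x, y) < \<epsilon>"
    if "x \<in> topspace X" "y \<in> topspace X" "add_truncation X d w c (x, y) < min \<epsilon> c" for x y \<epsilon>
  proof -
    have "d (x, y) \<ge> 0"
      using d that by (auto simp: CPM_def pseudometric_on_def PiE_iff)
    then show ?thesis
      using that by (auto simp: add_truncation_def min_def split: if_splits)
  qed
  then have "uniformly_continuous_id (topspace X) (add_truncation X d w c) w"
    unfolding uniformly_continuous_id_def using c by (metis min_less_iff_conj)
  then show ?thesis
    using add_truncation_in_CPM[OF d w] c by (simp add: unif_id_set_def)
qed

lemma closure_of_unif_id_set:
  assumes "w \<in> CPM X"
  shows "CPM_topology X closure_of unif_id_set X w = CPM X"
proof -
  have "\<exists>e\<in>unif_id_set X w. e \<in> U" if dU: "d \<in> U" "openin (CPM_topology X) U" for d U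
  proof -
    obtain r where r: "r > 0" "CPM_ball X d r \<subseteq> U" and d: "d \<in> CPM X"
      using dU unfolding openin_CPM_topology by blast
    let ?e = "add_truncation X d w (r/2)"
    have "CPM_dist X d ?e \<le> ennreal (r/2)"
      using CPM_dist_add_truncation_le[OF assms] r(1) by simp
    also have "\<dots> < ennreal r"
      using r(1) by (simp add: ennreal_less_iff)
    finally have "?e \<in> CPM_ball X d r"
      using add_truncation_in_CPM[OF d assms] r(1) by (simp add: CPM_ball_def)
    moreover have "?e \<in> unif_id_set X w"
      using add_truncation_in_unif_id_set[OF d assms] r(1) by simp
    ultimately show ?thesis
      using r(2) by blast
  qed
  then show ?thesis
    unfolding closure_of_def by auto
qed

theorem theorem1p2:
  fixes X :: "'a topology" and w :: "'a \<times> 'a \<Rightarrow> real"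
  assumes "metrizable_space X" and "w \<in> CPM X"
  shows "comeager_in (CPM_topology X) (unif_id_set X w)"
  unfolding comeager_in_def
proof (intro conjI exI allI)
  show "unif_id_set X w \<subseteq> topspace (CPM_topology X)"
    by (auto simp: unif_id_set_def)
next
  fix n :: nat
  let ?G = "modulus_set X w (inverse (real (Suc n)))"
  show "openin (CPM_topology X) ?G"
    by (rule openin_modulus_set)
  have "CPM_topology X closure_of unif_id_set X w \<subseteq> CPM_topology X closure_of ?G"
    by (intro closure_of_mono unif_id_set_subset_modulus_set) simp
  then show "CPM_topology X closure_of ?G = topspace (CPM_topology X)"
    using closure_of_unif_id_set[OF assms(2)] closure_of_subset_topspace[of "CPM_topology X" ?G]
    by auto
next
  show "(\<Inter>n. modulus_set X w (inverse (real (Suc n)))) \<subseteq> unif_id_set X w"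
    by (rule Inter_modulus_set_subset_unif_id_set)
qed

end
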